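(* Let $G$ be a quasi-line graph and $\omega=\omega(G)$. Then either $G$ is the line graph of a (loopless) multigraph, or there exist a vertex $v$ and a set $S\subseteq N_G(v)$ such that every vertex $u\in S\cup\{v\}$ satisfies $\deg_{G^2}(u)\le \omega^2+\omega$, and $N_G(v)\setminus S$ is a clique in $(G\setminus v)^2$ (i.e. any two distinct vertices of $N_G(v)\setminus S$ are at distance at most $2$ in $G\setminus v$).
   Context: Graphs are finite and simple. A graph is a quasi-line graph if every vertex neighbourhood induces a subgraph whose vertex set is the union of two cliques. $G^2$ is the graph on $V(G)$ where distinct vertices are adjacent iff at distance at most $2$ in $G$. The line graph $L(F)$ of a loopless multigraph $F$ has the edges of $F$ (parallel edges counted separately) as vertices, two being adjacent iff they share an endpoint. $\omega$ is the clique number. *)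

theory Defs
  imports Main
begin

definition sgraph :: "'a set \<Rightarrow> ('a \<Rightarrow> 'a \<Rightarrow> bool) \<Rightarrow> bool" where
  "sgraph V E \<longleftrightarrow> finite V \<and> (\<forall>x y. E x y \<longrightarrow> x \<in> V \<and> y \<in> V)
     \<and> (\<forall>x y. E x y \<longrightarrow> E y x) \<and> (\<forall>x. \<not> E x x)"

definition nbhd :: "'a set \<Rightarrow> ('a \<Rightarrow> 'a \<Rightarrow> bool) \<Rightarrow> 'a \<Rightarrow> 'a set" where
  "nbhd V E v = {u \<in> V. E v u}"

definition is_clique :: "'a set \<Rightarrow> ('a \<Rightarrow> 'a \<Rightarrow> bool) \<Rightarrow> 'a set \<Rightarrow> bool" where
  "is_clique V E K \<longleftrightarrow> K \<subseteq> V \<and> (\<forall>x\<in>K. \<forall>y\<in>K. x \<noteq> y \<longrightarrow> E x y)"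

definition clique_number :: "'a set \<Rightarrow> ('a \<Rightarrow> 'a \<Rightarrow> bool) \<Rightarrow> nat" where
  "clique_number V E = Max {card K | K. is_clique V E K}"

definition quasi_line :: "'a set \<Rightarrow> ('a \<Rightarrow> 'a \<Rightarrow> bool) \<Rightarrow> bool" where
  "quasi_line V E \<longleftrightarrow> (\<forall>v\<in>V. \<exists>A B. is_clique V E A \<and> is_clique V E B \<and> nbhd V E v = A \<union> B)"

definition sq_adj :: "'a set \<Rightarrow> ('a \<Rightarrow> 'a \<Rightarrow> bool) \<Rightarrow> 'a \<Rightarrow> 'a \<Rightarrow> bool" where
  "sq_adj V E x y \<longleftrightarrow> x \<in> V \<and> y \<in> V \<and> x \<noteq> y \<and> (E x y \<or> (\<exists>w\<in>V. E x w \<and> E w y))"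

definition sq_degree :: "'a set \<Rightarrow> ('a \<Rightarrow> 'a \<Rightarrow> bool) \<Rightarrow> 'a \<Rightarrow> nat" where
  "sq_degree V E x = card {y \<in> V. sq_adj V E x y}"

definition del_vertex :: "('a \<Rightarrow> 'a \<Rightarrow> bool) \<Rightarrow> 'a \<Rightarrow> 'a \<Rightarrow> 'a \<Rightarrow> bool" where
  "del_vertex E v x y \<longleftrightarrow> E x y \<and> x \<noteq> v \<and> y \<noteq> v"

text \<open>G is (isomorphic to) the line graph of a loopless multigraph F: the edges of F are
  the vertices of G (so parallel edges are distinct vertices), each with a set of exactly two
  endpoints in F (vertex set of F taken within nat), adjacent iff they share an endpoint.\<close>
definition is_line_graph_of_multigraph :: "'a set \<Rightarrow> ('a \<Rightarrow> 'a \<Rightarrow> bool) \<Rightarrow> bool" where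
  "is_line_graph_of_multigraph V E \<longleftrightarrow>
     (\<exists>ends :: 'a \<Rightarrow> nat set. (\<forall>e\<in>V. card (ends e) = 2) \<and>
        (\<forall>e\<in>V. \<forall>f\<in>V. E e f \<longleftrightarrow> e \<noteq> f \<and> ends e \<inter> ends f \<noteq> {}))"

end

theory Submission
  imports Defs
begin

text \<open>
  Write w for the clique number and call v big if its degree in the square exceeds w^2 + w. Taking
  for S the small neighbours of a small vertex v, the second alternative can only fail for every v
  if every small v has two big nonadjacent neighbours whose only common neighbour is v.

  Cover a closed neighbourhood N[v] by two cliques P and Q, putting into both of them the vertices
  that dominate v. For big v the number of vertices at distance two forces that this cover is
  unique, that the dominating vertices are true twins of v, and that adjacent a in P and b in Q
  have the same neighbours outside N[v]. Hence P and Q are also members of the covers of all their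
  vertices. For small v uniqueness comes from the two big neighbours, whose cliques through v
  are those of the cover of v. So the cliques of the big vertices cover every edge, and exactly two
  of them contain a given vertex; they are the vertices of the multigraph.
\<close>

text \<open>Each left-hand side bounds the degree in the square in a situation to be excluded for
  big vertices. The fourth stays only one below the threshold.\<close>

lemma threshold_bounds:
  fixes n :: nat
  assumes "0 < n"
  shows "2 * (n - 1) + 2 * (n - 1) \<le> n\<^sup>2 + n"
    and "2 * (n - 1) + (2 * (n - 1) + 1) \<le> n\<^sup>2 + n"
    and "(n - 1) + (n - 1) * (n - 1) \<le> n\<^sup>2 + n"
    and "2 * (n - 1) + (n + (n - 1) * (n - 1)) \<le> n\<^sup>2 + n"
proof -
  obtain m where Suc: "n = Suc m"
    using assms gr0_implies_Suc by blast
  have m: "m \<le> m * m"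
    by simp
  have n: "n - 1 = m" "n\<^sup>2 + n = m * m + 3 * m + 2"
    by (simp_all add: Suc power2_eq_square)
  show "2 * (n - 1) + 2 * (n - 1) \<le> n\<^sup>2 + n"
    "2 * (n - 1) + (2 * (n - 1) + 1) \<le> n\<^sup>2 + n"
    "(n - 1) + (n - 1) * (n - 1) \<le> n\<^sup>2 + n"
    "2 * (n - 1) + (n + (n - 1) * (n - 1)) \<le> n\<^sup>2 + n"
    unfolding n using m Suc by linarith+
qed

section \<open>Closed neighbourhoods and their covers by two cliques\<close>

locale quasi_line_graph =
  fixes V :: "'a set" and E :: "'a \<Rightarrow> 'a \<Rightarrow> bool"
  assumes sgraph: "sgraph V E" and quasi_line: "quasi_line V E"
begin

abbreviation \<omega> :: nat where
  "\<omega> \<equiv> clique_number V E"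

text \<open>Adjacency or equality in V; with it, statements about neighbourhoods need no distinctness
  side conditions.\<close>

definition adjeq :: "'a \<Rightarrow> 'a \<Rightarrow> bool" (infix "\<approx>" 50) where
  "x \<approx> y \<longleftrightarrow> x \<in> V \<and> y \<in> V \<and> (x = y \<or> E x y)"

definition cnbhd :: "'a \<Rightarrow> 'a set" where
  "cnbhd v = {u. v \<approx> u}"

text \<open>The instances \<open>x = y\<close> force \<open>K\<close> to lie inside
  \<open>V\<close>.\<close>

definition clq :: "'a set \<Rightarrow> bool" where
  "clq K \<longleftrightarrow> (\<forall>x\<in>K. \<forall>y\<in>K. x \<approx> y)"

definition outer :: "'a \<Rightarrow> 'a \<Rightarrow> 'a set" where
  "outer v u = cnbhd u - cnbhd v"

definition second_nbhd :: "'a \<Rightarrow> 'a set" where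
  "second_nbhd v = (\<Union>u\<in>cnbhd v. outer v u)"

definition dominators :: "'a \<Rightarrow> 'a set" where
  "dominators v = {i \<in> cnbhd v. cnbhd v \<subseteq> cnbhd i}"

text \<open>The dominating vertices lie in both cliques because only this normalisation can make the
  pair of cliques unique.\<close>

definition split :: "'a \<Rightarrow> 'a set \<Rightarrow> 'a set \<Rightarrow> bool" where
  "split v P Q \<longleftrightarrow> P \<union> Q = cnbhd v \<and> P \<inter> Q = dominators v \<and> clq P \<and> clq Q"

definition big :: "'a \<Rightarrow> bool" where
  "big v \<longleftrightarrow> v \<in> V \<and> \<omega>\<^sup>2 + \<omega> < sq_degree V E v"

lemma finite_V: "finite V"
  and E_in_V: "E x y \<Longrightarrow> x \<in> V \<and> y \<in> V"
  and E_sym: "E x y \<Longrightarrow> E y x"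
  and E_irrefl: "\<not> E x x"
  using sgraph unfolding sgraph_def by blast+

lemma adjeq_refl: "x \<in> V \<Longrightarrow> x \<approx> x"
  by (simp add: adjeq_def)

lemma adjeq_sym: "x \<approx> y \<Longrightarrow> y \<approx> x"
  unfolding adjeq_def using E_sym by blast

lemma adjeq_in_V: "x \<approx> y \<Longrightarrow> x \<in> V" "x \<approx> y \<Longrightarrow> y \<in> V"
  by (auto simp: adjeq_def)

lemma adjeq_iff: "x \<approx> y \<longleftrightarrow> x \<in> V \<and> x = y \<or> E x y"
  unfolding adjeq_def using E_in_V by blast

lemma clq_iff_is_clique: "clq K \<longleftrightarrow> is_clique V E K"
  unfolding clq_def is_clique_def adjeq_def by blast

lemma clq_subset_V: "clq K \<Longrightarrow> K \<subseteq> V"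
  by (simp add: clq_iff_is_clique is_clique_def)

lemma clqD: "clq K \<Longrightarrow> x \<in> K \<Longrightarrow> y \<in> K \<Longrightarrow> x \<approx> y"
  by (simp add: clq_def)

lemma clq_finite: "clq K \<Longrightarrow> finite K"
  using clq_subset_V finite_V finite_subset by blast

lemma cnbhd_subset_V: "cnbhd v \<subseteq> V"
  by (auto simp: cnbhd_def adjeq_def)

lemma finite_cnbhd: "finite (cnbhd v)"
  using cnbhd_subset_V finite_V finite_subset by blast

lemma finite_outer: "finite (outer v u)"
  by (simp add: outer_def finite_cnbhd)

lemma mem_cnbhd [simp]: "u \<in> cnbhd v \<longleftrightarrow> v \<approx> u"
  by (simp add: cnbhd_def)

lemma mem_outer [simp]: "c \<in> outer v u \<longleftrightarrow> u \<approx> c \<and> \<not> v \<approx> c"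
  by (simp add: outer_def)

lemma mem_dominators: "i \<in> dominators v \<longleftrightarrow> v \<approx> i \<and> (\<forall>x. v \<approx> x \<longrightarrow> i \<approx> x)"
  by (auto simp: dominators_def)

lemma card_clq_le:
  assumes "clq K"
  shows "card K \<le> \<omega>"
proof -
  have "{card K |K. is_clique V E K} \<subseteq> {..card V}"
    using finite_V card_mono by (fastforce simp: is_clique_def)
  then have "finite {card K |K. is_clique V E K}"
    using finite_subset by blast
  then show ?thesis
    unfolding clique_number_def using assms clq_iff_is_clique by (intro Max_ge) auto
qed

lemma clique_number_pos:
  assumes "v \<in> V"
  shows "0 < \<omega>"
  using card_clq_le[of "{v}"] assms by (simp add: clq_def adjeq_refl)

text \<open>The vertex \<open>v\<close> joins both cliques of the quasi-line cover of its open
  neighbourhood.\<close>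

lemma clq_cover:
  assumes "v \<in> V"
  obtains P Q where "clq P" "clq Q" "P \<union> Q = cnbhd v" "v \<in> P" "v \<in> Q"
proof -
  obtain A B where A: "is_clique V E A" and B: "is_clique V E B" and AB: "nbhd V E v = A \<union> B"
    using quasi_line assms unfolding quasi_line_def by blast
  have adj: "E v x" "E x v" if "x \<in> A \<union> B" for x
    using that AB E_sym unfolding nbhd_def by blast+
  have "is_clique V E (insert v A)" "is_clique V E (insert v B)"
    using A B assms adj unfolding is_clique_def by (metis UnI1 UnI2 insert_iff insert_subset)+
  moreover have "insert v A \<union> insert v B = cnbhd v"
    using assms AB unfolding nbhd_def adjeq_def cnbhd_def by blast
  ultimately show thesis
    using that clq_iff_is_clique by blast
qed

section \<open>Forbidden patterns in a neighbourhood\<close>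

text \<open>Two of the three vertices fall into the same one of two covering cliques.\<close>

lemma no_independent_triple:
  assumes "u \<approx> x" "u \<approx> y" "u \<approx> z"
  shows "x \<approx> y \<or> y \<approx> z \<or> x \<approx> z"
proof -
  obtain P Q where PQ: "clq P" "clq Q" "P \<union> Q = cnbhd u"
    using clq_cover adjeq_in_V(1)[OF assms(1)] by metis
  have "x \<in> P \<union> Q" "y \<in> P \<union> Q" "z \<in> P \<union> Q"
    unfolding PQ(3) using assms by simp_all
  then show ?thesis
    using clqD[OF PQ(1)] clqD[OF PQ(2)] by blast
qed

text \<open>Inside a closed neighbourhood the complement graph is bipartite, so it has no closed
  walk of length five.\<close>

lemma no_antipentagon:
  assumes "u \<approx> x1" "u \<approx> x2" "u \<approx> x3" "u \<approx> x4" "u \<approx> x5"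
    and "\<not> x1 \<approx> x2" "\<not> x2 \<approx> x3" "\<not> x3 \<approx> x4" "\<not> x4 \<approx> x5" "\<not> x5 \<approx> x1"
  shows False
proof -
  obtain P Q where PQ: "clq P" "clq Q" "P \<union> Q = cnbhd u"
    using clq_cover adjeq_in_V(1)[OF assms(1)] by metis
  have "x1 \<in> P \<union> Q" "x2 \<in> P \<union> Q" "x3 \<in> P \<union> Q" "x4 \<in> P \<union> Q" "x5 \<in> P \<union> Q"
    unfolding PQ(3) using assms by simp_all
  then show ?thesis
    using clqD[OF PQ(1)] clqD[OF PQ(2)] assms(6-) by blast
qed

section \<open>Counting second neighbours\<close>

text \<open>The triple \<open>v\<close>, \<open>c\<close>, \<open>d\<close> around \<open>u\<close>
  cannot be independent, and \<open>v\<close> is adjacent to neither \<open>c\<close> nor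
  \<open>d\<close>.\<close>

lemma outer_clq:
  assumes "v \<approx> u" "c \<in> outer v u" "d \<in> outer v u"
  shows "c \<approx> d"
  using no_independent_triple[of u v c d] adjeq_sym[OF assms(1)] assms(2,3) by auto

text \<open>The vertex \<open>u\<close> extends the clique \<open>outer v u\<close>, which saves
  one.\<close>

lemma card_outer_le:
  assumes "v \<approx> u"
  shows "card (outer v u) \<le> \<omega> - 1"
proof -
  have "u \<approx> c" "c \<approx> u" if "c \<in> outer v u" for c
    using that adjeq_sym[of u c] by simp_all
  moreover have "u \<approx> u"
    using assms adjeq_refl adjeq_in_V(2) by blast
  ultimately have "clq (insert u (outer v u))"
    unfolding clq_def using outer_clq[OF assms] by blast
  then have "card (insert u (outer v u)) \<le> \<omega>"
    by (rule card_clq_le)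
  moreover have "u \<notin> outer v u"
    using assms by simp
  ultimately show ?thesis
    by (simp add: finite_outer)
qed

text \<open>The term of \<open>v\<close> itself is empty, and at most \<omega> - 1 other members of
  \<open>K\<close> remain.\<close>

lemma card_Union_outer_le:
  assumes "clq K" "v \<in> K"
  shows "card (\<Union>u\<in>K. outer v u) \<le> (\<omega> - 1) * (\<omega> - 1)"
proof -
  have fin: "finite K"
    using assms clq_finite by blast
  have "(\<Union>u\<in>K. outer v u) = (\<Union>u\<in>K - {v}. outer v u)"
    by auto
  also have "card \<dots> \<le> (\<Sum>u\<in>K - {v}. card (outer v u))"
    using fin by (intro card_UN_le) simp
  also have "\<dots> \<le> (\<Sum>u\<in>K - {v}. \<omega> - 1)"
    using card_outer_le clqD[OF assms] by (intro sum_mono) simp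
  also have "\<dots> = (card K - 1) * (\<omega> - 1)"
    using assms(2) fin by simp
  also have "\<dots> \<le> (\<omega> - 1) * (\<omega> - 1)"
    using card_clq_le[OF assms(1)] by (intro mult_le_mono1) simp
  finally show ?thesis .
qed

lemma sq_degree_eq:
  assumes "v \<in> V"
  shows "sq_degree V E v = card (cnbhd v - {v}) + card (second_nbhd v)"
proof -
  have "{y \<in> V. sq_adj V E v y} = (cnbhd v - {v}) \<union> second_nbhd v"
  proof (rule set_eqI)
    fix y
    have second: "y \<in> second_nbhd v \<longleftrightarrow> (\<exists>u. v \<approx> u \<and> u \<approx> y) \<and> \<not> v \<approx> y"
      unfolding second_nbhd_def by auto
    have path: "(\<exists>u. v \<approx> u \<and> u \<approx> y) \<longleftrightarrow> v \<approx> y \<or> (\<exists>u\<in>V. E v u \<and> E u y)"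
      using assms E_in_V unfolding adjeq_iff by metis
    show "y \<in> {y \<in> V. sq_adj V E v y} \<longleftrightarrow> y \<in> (cnbhd v - {v}) \<union> second_nbhd v"
      unfolding Un_iff second path using assms E_in_V E_irrefl
      by (auto simp: sq_adj_def adjeq_iff)
  qed
  moreover have "(cnbhd v - {v}) \<inter> second_nbhd v = {}"
    unfolding second_nbhd_def by auto
  moreover have "finite (second_nbhd v)"
    unfolding second_nbhd_def using finite_cnbhd finite_outer by blast
  ultimately show ?thesis
    unfolding sq_degree_def by (simp add: card_Un_disjoint finite_cnbhd)
qed

lemma card_cnbhd_le:
  assumes "v \<in> V"
  shows "card (cnbhd v - {v}) \<le> 2 * (\<omega> - 1)"
proof -
  obtain P Q where PQ: "clq P" "clq Q" "P \<union> Q = cnbhd v" "v \<in> P" "v \<in> Q"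
    using clq_cover[OF assms] .
  have "cnbhd v - {v} = (P - {v}) \<union> (Q - {v})"
    using PQ by blast
  then have "card (cnbhd v - {v}) \<le> card (P - {v}) + card (Q - {v})"
    by (simp add: card_Un_le)
  then show ?thesis
    using PQ card_clq_le[of P] card_clq_le[of Q] clq_finite by (simp add: card_Diff_singleton)
qed

section \<open>Vertices of large degree in the square\<close>

lemma big_in_V: "big v \<Longrightarrow> v \<in> V"
  by (simp add: big_def)

lemma big_card_nbhds:
  assumes "big v"
  shows "\<omega>\<^sup>2 + \<omega> < card (cnbhd v - {v}) + card (second_nbhd v)"
  using assms sq_degree_eq[OF big_in_V[OF assms]] by (simp add: big_def)

lemma big_card_second_nbhd:
  assumes "big v"
  shows "\<omega>\<^sup>2 + \<omega> < 2 * (\<omega> - 1) + card (second_nbhd v)"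
  using big_card_nbhds[OF assms] card_cnbhd_le[OF big_in_V[OF assms]] by linarith

lemmas big_threshold_bounds = threshold_bounds[OF clique_number_pos[OF big_in_V]]

text \<open>Otherwise \<open>v\<close> would have at most \<omega> - 1 neighbours and at most
  (\<omega> - 1)^2 second neighbours.\<close>

lemma big_not_clq:
  assumes "big v"
  shows "\<not> clq (cnbhd v)"
proof
  assume K: "clq (cnbhd v)"
  have v: "v \<in> cnbhd v"
    using assms adjeq_refl by (simp add: big_def)
  have "card (cnbhd v - {v}) \<le> \<omega> - 1"
    using card_clq_le[OF K] v finite_cnbhd by simp
  then show False
    using big_card_nbhds[OF assms] card_Union_outer_le[OF K v] big_threshold_bounds(3)[OF assms]
    unfolding second_nbhd_def by linarith
qed

text \<open>If N[v] is the join of X and Y, a second neighbour of v misses no nonadjacent pair in the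
  part not containing its neighbour in N[v]. So it is adjacent to p or q, which leaves too few
  second neighbours.\<close>

lemma big_no_join:
  assumes v: "big v" and XY: "cnbhd v = X \<union> Y" and join: "\<And>x y. x \<in> X \<Longrightarrow> y \<in> Y \<Longrightarrow> x \<approx> y"
    and pq: "p \<in> X" "q \<in> X" "\<not> p \<approx> q" and rs: "r \<in> Y" "s \<in> Y"
  shows "r \<approx> s"
proof (rule ccontr)
  assume nrs: "\<not> r \<approx> s"
  have Y: "c \<in> outer v p \<union> outer v q" if "u \<in> Y" "u \<approx> c" "\<not> v \<approx> c" for u c
  proof -
    have "p \<approx> c \<or> q \<approx> c"
      using no_independent_triple[of u c p q] join[OF pq(1) that(1)] join[OF pq(2) that(1)]
        that(2) pq(3) adjeq_sym by blast
    then show ?thesis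
      using that(3) by simp
  qed
  have X: "c \<in> outer v p \<union> outer v q" if "u \<in> X" "u \<approx> c" "\<not> v \<approx> c" for u c
  proof -
    \<comment> \<open>Since \<open>r\<close> and \<open>s\<close> lie in \<open>Y\<close>, whichever
      of them sees \<open>c\<close> brings this case back to \<open>Y\<close>.\<close>
    have "r \<approx> c \<or> s \<approx> c"
      using no_independent_triple[of u c r s] join[OF that(1) rs(1)] join[OF that(1) rs(2)]
        that nrs adjeq_sym by blast
    then show ?thesis
      using Y rs that(3) by blast
  qed
  have "second_nbhd v \<subseteq> outer v p \<union> outer v q"
    using X Y XY unfolding second_nbhd_def by fastforce
  then have "card (second_nbhd v) \<le> card (outer v p) + card (outer v q)"
    by (meson card_Un_le card_mono finite_UnI finite_outer le_trans)
  moreover have "v \<approx> p" "v \<approx> q"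
    using pq XY mem_cnbhd by blast+
  ultimately have "card (second_nbhd v) \<le> 2 * (\<omega> - 1)"
    using card_outer_le[of v p] card_outer_le[of v q] by linarith
  then show False
    using big_card_second_nbhd[OF v] big_threshold_bounds(1)[OF v] by linarith
qed

section \<open>Splits of closed neighbourhoods\<close>

lemma split_sym: "split v P Q \<Longrightarrow> split v Q P"
  by (simp add: split_def Un_commute Int_commute)

text \<open>Adding the dominators of \<open>v\<close> to both cliques of a cover keeps them cliques.
  Conversely, a vertex in both cliques sees the whole closed neighbourhood and so is a
  dominator.\<close>

lemma split_exists:
  assumes "v \<in> V"
  obtains P Q where "split v P Q"
proof -
  obtain P Q where PQ: "clq P" "clq Q" "P \<union> Q = cnbhd v"
    using clq_cover[OF assms] .
  let ?D = "dominators v"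
  have adj: "d \<approx> x" "x \<approx> d" if "d \<in> ?D" "x \<in> P \<union> Q \<union> ?D" for d x
  proof -
    have "v \<approx> x"
      using that(2) PQ(3) mem_cnbhd[of x v] unfolding dominators_def by blast
    then show "d \<approx> x"
      using that(1) by (simp add: mem_dominators)
    then show "x \<approx> d"
      by (rule adjeq_sym)
  qed
  have "clq (P \<union> ?D)" "clq (Q \<union> ?D)"
    using PQ(1,2) adj unfolding clq_def by blast+
  moreover have "(P \<union> ?D) \<union> (Q \<union> ?D) = cnbhd v"
    using PQ(3) unfolding dominators_def by blast
  moreover have "P \<inter> Q \<subseteq> ?D"
  proof
    fix i assume i: "i \<in> P \<inter> Q"
    then have "v \<approx> i" "\<And>x. x \<in> P \<union> Q \<Longrightarrow> i \<approx> x"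
      using PQ(3) mem_cnbhd clqD[OF PQ(1)] clqD[OF PQ(2)] by blast+
    then show "i \<in> ?D"
      using PQ(3) by (simp add: mem_dominators)
  qed
  ultimately have "split v (P \<union> ?D) (Q \<union> ?D)"
    unfolding split_def by blast
  then show thesis ..
qed

lemma splitD:
  assumes "split v P Q"
  shows "P \<union> Q = cnbhd v" "P \<inter> Q = dominators v" "clq P" "clq Q"
  using assms unfolding split_def by auto

lemma split_self:
  assumes "split v P Q" "v \<in> V"
  shows "v \<in> P" "v \<in> Q"
  using splitD(2)[OF assms(1)] assms(2) adjeq_refl mem_dominators by blast+

text \<open>As \<open>b\<close> is no dominator, it misses some vertex of the closed neighbourhood,
  which cannot lie in the clique \<open>Q\<close>.\<close>

lemma split_nonadjacent:
  assumes "split v P Q" "b \<in> Q" "b \<notin> P"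
  obtains a where "a \<in> P" "a \<notin> Q" "\<not> a \<approx> b"
proof -
  note PQ = splitD[OF assms(1)]
  have "v \<approx> b"
    using assms(2) PQ(1) by auto
  then obtain a where a: "v \<approx> a" "\<not> b \<approx> a"
    using assms PQ(2) mem_dominators by blast
  then have "a \<notin> Q"
    using assms(2) clqD[OF PQ(4)] by blast
  moreover have "a \<in> P"
    using a calculation PQ(1) mem_cnbhd by blast
  ultimately show thesis
    using that a adjeq_sym by blast
qed

section \<open>Splits of big vertices\<close>

text \<open>The splits agree on \<open>?X\<close> and cross on \<open>?Y\<close>, and any vertex of
  one part shares a clique with any vertex of the other. If \<open>z\<close> were not in
  \<open>P'\<close>, then \<open>x\<close> and a non-neighbour of it would lie in \<open>?X\<close>,
  and \<open>z\<close> and a non-neighbour of it in \<open>?Y\<close>, against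
  \<open>big_no_join\<close>.\<close>

lemma big_split_unique_aux:
  assumes v: "big v" and s: "split v P Q" "split v P' Q'"
    and x: "x \<in> P" "x \<notin> Q" "x \<in> P'" and z: "z \<in> P" "z \<notin> Q"
  shows "z \<in> P'"
proof (rule ccontr)
  assume nz: "z \<notin> P'"
  note D = splitD[OF s(1)] and D' = splitD[OF s(2)]
  let ?X = "(P \<inter> P') \<union> (Q \<inter> Q')" and ?Y = "(P \<inter> Q') \<union> (Q \<inter> P')"
  have XY: "cnbhd v = ?X \<union> ?Y"
    using D(1) D'(1) by blast
  have join: "a \<approx> b" if "a \<in> ?X" "b \<in> ?Y" for a b
    using that clqD[OF D(3)] clqD[OF D(4)] clqD[OF D'(3)] clqD[OF D'(4)] by blast
  obtain y where y: "y \<in> Q" "y \<notin> P" "\<not> y \<approx> x"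
    using split_nonadjacent[OF split_sym[OF s(1)] x(1,2)] .
  then have yX: "y \<in> ?X"
    using D(1) D'(1) x(3) clqD[OF D'(3)] by blast
  obtain t where t: "t \<in> Q" "t \<notin> P" "\<not> t \<approx> z"
    using split_nonadjacent[OF split_sym[OF s(1)] z] .
  have zQ': "z \<in> Q'"
    using nz z D(1) D'(1) by blast
  then have tY: "t \<in> ?Y"
    using t D(1) D'(1) clqD[OF D'(4)] by blast
  have "t \<approx> z"
    using big_no_join[OF v XY join, of y x t z] yX tY x z zQ' y(3) by blast
  then show False
    using t by blast
qed

text \<open>Nonadjacent \<open>x\<close> and \<open>y\<close> lie in different cliques of each
  split, which tells which cliques correspond. \<open>big_split_unique_aux\<close> then carries over
  the remaining vertices.\<close>

lemma big_split_unique: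
  assumes v: "big v" and s: "split v P Q" "split v P' Q'"
  shows "{P, Q} = {P', Q'}"
proof -
  have sub: "P1 = P2"
    if s1: "split v P1 Q1" and s2: "split v P2 Q2" and x: "x \<in> P1" "x \<notin> Q1" "x \<in> P2"
    for P1 Q1 P2 Q2 x
  proof
    have eq: "P1 \<inter> Q1 = P2 \<inter> Q2"
      using splitD(2)[OF s1] splitD(2)[OF s2] by simp
    show "P1 \<subseteq> P2"
      using big_split_unique_aux[OF v s1 s2 x] eq by blast
    have "x \<notin> Q2"
      using x eq by blast
    then show "P2 \<subseteq> P1"
      using big_split_unique_aux[OF v s2 s1 x(3) _ x(1)] eq by blast
  qed
  note D = splitD[OF s(1)] and D' = splitD[OF s(2)]
  have "cnbhd v \<noteq> Q"
    using big_not_clq[OF v] D by metis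
  then obtain x where x: "x \<in> P" "x \<notin> Q"
    using D(1) by blast
  obtain y where y: "y \<in> Q" "y \<notin> P" "\<not> y \<approx> x"
    using split_nonadjacent[OF split_sym[OF s(1)] x(1,2)] .
  have xy: "x \<in> P' \<union> Q'" "y \<in> P' \<union> Q'"
    using D(1) D'(1) x y by blast+
  show ?thesis
  proof (cases "x \<in> P'")
    case True
    then have "y \<in> Q'"
      using xy y(3) clqD[OF D'(3)] by blast
    then have "P = P'" "Q = Q'"
      using sub[OF s x True] sub[OF split_sym[OF s(1)] split_sym[OF s(2)] y(1,2)] by auto
    then show ?thesis
      by simp
  next
    case False
    then have "x \<in> Q'"
      using xy by blast
    then have "y \<in> P'"
      using xy y(3) clqD[OF D'(4)] by blast
    then have "P = Q'" "Q = P'"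
      using sub[OF s(1) split_sym[OF s(2)] x \<open>x \<in> Q'\<close>] sub[OF split_sym[OF s(1)] s(2) y(1,2)] by auto
    then show ?thesis
      by blast
  qed
qed

text \<open>Otherwise the second neighbours of v seen
  only from P would form a clique, so that v would have at most w + (w - 1)^2 of them.\<close>

lemma big_outer_subset:
  assumes v: "big v" and s: "split v P Q"
    and a: "a \<in> P" and b: "b \<in> Q" "b \<notin> P" and ab: "a \<approx> b"
  shows "outer v a \<subseteq> outer v b"
proof (rule ccontr)
  assume "\<not> outer v a \<subseteq> outer v b"
  then obtain c where "c \<in> outer v a" "c \<notin> outer v b"
    by blast
  then have c: "a \<approx> c" "\<not> v \<approx> c" "\<not> b \<approx> c"
    by simp_all
  note D = splitD[OF s]
  note vV = big_in_V[OF v]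
  note vPQ = split_self[OF s vV]
  define M where "M = {m \<in> P. \<not> m \<approx> b}"
  obtain m0 where m0: "m0 \<in> M"
    using split_nonadjacent[OF s b] unfolding M_def by blast
  have P: "v \<approx> x" if "x \<in> P" for x
    using clqD[OF D(3) vPQ(1) that] .
  have Padj: "x \<approx> y" if "x \<in> P" "y \<in> P" for x y
    using clqD[OF D(3) that] .
  \<comment> \<open>The nonadjacent \<open>m\<close> and \<open>b\<close> are both neighbours of
    \<open>u\<close>, so a third neighbour \<open>d\<close> is adjacent to one of them.\<close>
  have cover: "m \<approx> d \<or> b \<approx> d" if "u \<in> P" "u \<approx> b" "d \<in> outer v u" "m \<in> M" for u d m
  proof -
    have "m \<in> P" "\<not> m \<approx> b" "u \<approx> d"
      using that unfolding M_def by simp_all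
    then show ?thesis
      using no_independent_triple[of u d m b] Padj[OF that(1)] that(2) adjeq_sym by meson
  qed
  have cM: "c \<in> outer v m" if "m \<in> M" for m
    using cover[OF a ab, of c m] that c by simp
  \<comment> \<open>Otherwise d, v, c, b, m would be an antipentagon around a.\<close>
  have aM: "m \<approx> d" if "d \<in> outer v a" "m \<in> M" for d m
  proof (rule ccontr)
    assume "\<not> m \<approx> d"
    moreover have "m \<in> P" "\<not> m \<approx> b" "a \<approx> d" "\<not> v \<approx> d"
      using that unfolding M_def by simp_all
    ultimately show False
      using no_antipentagon[of a d v c b m] c ab Padj[OF a] vPQ(1) adjeq_sym by meson
  qed
  have clqM: "d \<approx> e" if m: "m \<in> M" "n \<in> M" and d: "d \<in> outer v m" and e: "e \<in> outer v n" for d e m n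
  proof (cases "d \<in> outer v n \<or> e \<in> outer v m")
    case True
    then show ?thesis
      using outer_clq[OF P] m d e unfolding M_def by blast
  next
    \<comment> \<open>By \<open>aM\<close> neither \<open>d\<close> nor \<open>e\<close> is adjacent
      to \<open>a\<close>, while \<open>c\<close> sees all three; the triple \<open>a\<close>,
      \<open>d\<close>, \<open>e\<close> around \<open>c\<close> then leaves only
      \<open>d \<approx> e\<close>.\<close>
    case False
    then have "\<not> a \<approx> d" "\<not> a \<approx> e"
      using aM[of d n] aM[of e m] m d e by auto
    moreover have "c \<approx> d" "c \<approx> e"
      using outer_clq[OF P] cM m d e unfolding M_def by blast+
    ultimately show ?thesis
      using no_independent_triple[of c a d e] c(1) adjeq_sym by blast
  qed
  let ?C = "\<Union>m\<in>M. outer v m" and ?D = "\<Union>u\<in>Q. outer v u"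
  have "clq ?C"
    unfolding clq_def using clqM by blast
  then have "card ?C \<le> \<omega>"
    by (rule card_clq_le)
  \<comment> \<open>Members of \<open>P\<close> outside \<open>M\<close> are adjacent to
    \<open>b\<close>, so what they see beyond \<open>v\<close> is also seen from \<open>m0\<close>
    or from \<open>b\<close>.\<close>
  have "d \<in> ?C \<union> ?D" if u: "u \<in> P" "d \<in> outer v u" for u d
  proof (cases "u \<in> M")
    case False
    then have "m0 \<approx> d \<or> b \<approx> d"
      using cover[OF u(1) _ u(2) m0] u(1) unfolding M_def by blast
    then show ?thesis
      using u(2) b(1) m0 by auto
  qed (use u in blast)
  then have sub: "second_nbhd v \<subseteq> ?C \<union> ?D"
    unfolding second_nbhd_def D(1)[symmetric] by blast
  moreover have "finite (?C \<union> ?D)"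
    using clq_finite[OF D(4)] clq_finite[OF \<open>clq ?C\<close>] finite_outer by blast
  ultimately have "card (second_nbhd v) \<le> card ?C + card ?D"
    by (meson card_Un_le card_mono le_trans)
  then have "card (second_nbhd v) \<le> \<omega> + (\<omega> - 1) * (\<omega> - 1)"
    using \<open>card ?C \<le> \<omega>\<close> card_Union_outer_le[OF D(4) vPQ(2)] by linarith
  then show False
    using big_card_second_nbhd[OF v] big_threshold_bounds(4)[OF v] by linarith
qed

section \<open>Cliques shared by the splits of neighbouring vertices\<close>

text \<open>An outer neighbour \<open>c\<close> of a dominator is seen from every non-dominator, and
  so is every vertex seen from a dominator. Each second neighbour of \<open>v\<close> thus shares a
  non-dominator with \<open>c\<close> and is adjacent or equal to \<open>c\<close>, which leaves too
  few of them.\<close>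

lemma big_dominator_cnbhd:
  assumes v: "big v" and i: "i \<in> dominators v"
  shows "cnbhd i = cnbhd v"
proof (rule ccontr)
  assume "cnbhd i \<noteq> cnbhd v"
  then obtain c where c: "i \<approx> c" "\<not> v \<approx> c"
    using i mem_dominators by (metis mem_cnbhd subsetI subset_antisym)
  note vV = big_in_V[OF v]
  obtain P Q where s: "split v P Q"
    using split_exists[OF vV] .
  note D = splitD[OF s]
  have s': "split v Q P"
    using split_sym[OF s] .
  \<comment> \<open>A dominator lies in both cliques, so \<open>big_outer_subset\<close> applies
    whichever clique contains \<open>b\<close>.\<close>
  have dom: "outer v j \<subseteq> outer v b" if j: "j \<in> dominators v" and b: "b \<in> cnbhd v - dominators v" for j b
  proof -
    have "j \<in> P" "j \<in> Q" "j \<approx> b"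
      using j b D(2) by (auto simp: mem_dominators)
    then show ?thesis
      using big_outer_subset[OF v s, of j b] big_outer_subset[OF v s', of j b] b D(1,2) by blast
  qed
  obtain b where b: "b \<in> cnbhd v - dominators v"
    using big_not_clq[OF v] unfolding clq_def by (metis DiffI mem_cnbhd mem_dominators)
  have "d \<in> cnbhd c" if u: "u \<in> cnbhd v" "d \<in> outer v u" for u d
  proof -
    obtain u' where u': "u' \<in> cnbhd v - dominators v" "d \<in> outer v u'"
      using u dom[of u b] b by blast
    moreover from this have "c \<in> outer v u'"
      using dom[OF i] c mem_outer by blast
    ultimately show ?thesis
      using outer_clq[of v u' c d] by simp
  qed
  then have "second_nbhd v \<subseteq> cnbhd c"
    unfolding second_nbhd_def by blast
  then have "card (second_nbhd v) \<le> card (cnbhd c)"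
    using card_mono finite_cnbhd by blast
  moreover have "c \<in> V"
    using c adjeq_in_V by blast
  moreover from this have "card (cnbhd c) = card (cnbhd c - {c}) + 1"
    using card.remove[of "cnbhd c" c] finite_cnbhd adjeq_refl by simp
  ultimately have "card (second_nbhd v) \<le> 2 * (\<omega> - 1) + 1"
    using card_cnbhd_le by force
  then show False
    using big_card_second_nbhd[OF v] big_threshold_bounds(2)[OF v] by linarith
qed

text \<open>A dominator \<open>a\<close> is a true twin of \<open>v\<close> and keeps its split.
  Otherwise \<open>R\<close> consists of the neighbours of \<open>a\<close> outside
  \<open>P\<close>, together with the dominators of \<open>a\<close> for the normalisation. It is a
  clique because \<open>a\<close> and its neighbours in \<open>Q\<close> outside \<open>P\<close>
  see the same vertices beyond \<open>v\<close>.\<close>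

lemma big_split_nbr:
  assumes v: "big v" and s: "split v P Q" and a: "a \<in> P"
  obtains R where "split a P R"
proof (cases "a \<in> Q")
  case True
  then have "cnbhd a = cnbhd v"
    using big_dominator_cnbhd[OF v] a splitD(2)[OF s] by blast
  then have "split a P Q"
    using s unfolding split_def dominators_def by simp
  then show ?thesis ..
next
  case False
  note D = splitD[OF s]
  note vV = big_in_V[OF v]
  have s': "split v Q P"
    using split_sym[OF s] .
  have dom: "x \<approx> y" "y \<approx> x" if "x \<in> dominators a" "y \<in> cnbhd a" for x y
  proof -
    show "x \<approx> y"
      using that by (simp add: mem_dominators)
    then show "y \<approx> x"
      by (rule adjeq_sym)
  qed
  have PV: "P \<subseteq> cnbhd a"
    using clqD[OF D(3) a] by auto
  have outer_eq: "outer v b = outer v a" if "b \<in> Q" "b \<notin> P" "a \<approx> b" for b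
    using big_outer_subset[OF v s a that] big_outer_subset[OF v s' that(1) a False] that adjeq_sym
    by blast
  have "clq (cnbhd a - P)"
    unfolding clq_def
  proof (intro ballI)
    fix x y assume xy: "x \<in> cnbhd a - P" "y \<in> cnbhd a - P"
    have mixed: "x \<approx> y" if x: "x \<in> cnbhd a - P" "v \<approx> x" and y: "y \<in> cnbhd a - P" "\<not> v \<approx> y" for x y
    proof -
      have "x \<in> Q"
        using x D(1) mem_cnbhd by blast
      then have "y \<in> outer v x"
        using outer_eq x y by auto
      then show ?thesis
        by simp
    qed
    have va: "v \<approx> a"
      using D(1) a by auto
    consider "v \<approx> x" "v \<approx> y" | "v \<approx> x" "\<not> v \<approx> y" | "\<not> v \<approx> x" "v \<approx> y" | "\<not> v \<approx> x" "\<not> v \<approx> y"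
      by blast
    then show "x \<approx> y"
    proof cases
      case 1
      then have "x \<in> Q" "y \<in> Q"
        using xy D(1) mem_cnbhd by blast+
      then show ?thesis
        using clqD[OF D(4)] by blast
    next
      case 2
      then show ?thesis using mixed xy by blast
    next
      case 3
      then show ?thesis using adjeq_sym[OF mixed[of y x]] xy by blast
    next
      case 4
      then show ?thesis using outer_clq[OF va, of x y] xy by simp
    qed
  qed
  moreover have da: "dominators a \<subseteq> cnbhd a"
    unfolding dominators_def by blast
  ultimately have clqR: "clq ((cnbhd a - P) \<union> dominators a)"
    using dom unfolding clq_def by blast
  \<comment> \<open>A dominator of \<open>a\<close> outside \<open>P\<close> would be a vertex of
    \<open>Q\<close> adjacent to all of \<open>P\<close>, but vertices of \<open>Q\<close> outside
    \<open>P\<close> miss some vertex of \<open>P\<close>.\<close>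
  have "dominators a \<subseteq> P"
  proof
    fix i assume i: "i \<in> dominators a"
    show "i \<in> P"
    proof (rule ccontr)
      assume "i \<notin> P"
      moreover have "i \<approx> v"
        using dom[OF i] split_self[OF s vV] PV by blast
      ultimately have iQ: "i \<in> Q"
        using D(1) adjeq_sym[of i v] mem_cnbhd by blast
      have "\<not> (\<forall>x\<in>P. x \<approx> i)"
        using split_nonadjacent[OF s iQ \<open>i \<notin> P\<close>] by blast
      then show False
        using dom[OF i] PV by blast
    qed
  qed
  then have "split a P ((cnbhd a - P) \<union> dominators a)"
    unfolding split_def using PV da clqR D(3) by blast
  then show ?thesis ..
qed

text \<open>The clique containing \<open>x\<close> must be the common closed neighbourhood of
  \<open>u\<close> and \<open>x\<close>: a vertex of it in the other clique would be adjacent to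
  both \<open>x\<close> and \<open>y\<close>, hence be \<open>u\<close>, which lies in both cliques.
  The same holds for \<open>y\<close>.\<close>

lemma split_unique_private_nbrs:
  assumes s: "split u P Q" "split u P' Q'" and uV: "u \<in> V"
    and x: "u \<approx> x" and y: "u \<approx> y" and xy: "\<not> x \<approx> y" "\<And>w. x \<approx> w \<Longrightarrow> w \<approx> y \<Longrightarrow> w = u"
  shows "{P, Q} = {P', Q'}"
proof -
  have det: "P = cnbhd u \<inter> cnbhd x \<and> Q = cnbhd u \<inter> cnbhd y"
    if s: "split u P Q" and xP: "x \<in> P" for P Q
  proof -
    note D = splitD[OF s]
    note uPQ = split_self[OF s uV]
    have yQ: "y \<in> Q"
      using y D(1) clqD[OF D(3) xP] xy(1) mem_cnbhd by blast
    have "P \<subseteq> cnbhd u \<inter> cnbhd x" "Q \<subseteq> cnbhd u \<inter> cnbhd y"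
      using D(1) clqD[OF D(3) xP] clqD[OF D(4) yQ] by auto
    moreover have "w \<in> P" if "w \<in> cnbhd u \<inter> cnbhd x" for w
      using that D(1) clqD[OF D(4) _ yQ] xy(2)[of w] uPQ by (metis IntE UnE mem_cnbhd)
    moreover have "w \<in> Q" if "w \<in> cnbhd u \<inter> cnbhd y" for w
      using that D(1) clqD[OF D(3) xP] xy(2)[of w] uPQ adjeq_sym by (metis IntE UnE mem_cnbhd)
    ultimately show ?thesis
      by blast
  qed
  have "x \<in> P \<or> x \<in> Q" "x \<in> P' \<or> x \<in> Q'"
    using splitD(1)[OF s(1)] splitD(1)[OF s(2)] x mem_cnbhd by blast+
  moreover have "split u Q P" "split u Q' P'"
    using split_sym s by auto
  ultimately show ?thesis
    using det[of P Q] det[of Q P] det[of P' Q'] det[of Q' P'] s by blast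
qed

section \<open>Krausz families of cliques and line graphs\<close>

text \<open>Splits are symmetric, so both cliques of each split at a big vertex are members.\<close>

definition big_cliques :: "'a set set" where
  "big_cliques = {P. \<exists>v Q. big v \<and> split v P Q}"

text \<open>The easy half of Krausz's characterisation: cliques become vertices of the multigraph,
  numbered by an injection, and a vertex of the graph becomes an edge joining its two cliques.
  Vertices with the same two cliques are parallel edges.\<close>

lemma line_graph_of_krausz_family:
  assumes fin: "finite F" and clq: "\<And>K. K \<in> F \<Longrightarrow> clq K"
    and two: "\<And>u. u \<in> V \<Longrightarrow> card {K \<in> F. u \<in> K} = 2"
    and edges: "\<And>u w. E u w \<Longrightarrow> \<exists>K\<in>F. u \<in> K \<and> w \<in> K"
  shows "is_line_graph_of_multigraph V E"
proof -
  obtain h :: "'a set \<Rightarrow> nat" where h: "inj_on h F"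
    using finite_imp_inj_to_nat_seg[OF fin] by blast
  define ends where "ends u = h ` {K \<in> F. u \<in> K}" for u
  have "card (ends u) = 2" if "u \<in> V" for u
    unfolding ends_def using two[OF that] inj_on_subset[OF h] by (subst card_image) auto
  moreover have "E u w \<longleftrightarrow> u \<noteq> w \<and> ends u \<inter> ends w \<noteq> {}" for u w
  proof
    assume "E u w"
    then show "u \<noteq> w \<and> ends u \<inter> ends w \<noteq> {}"
      using edges[of u w] E_irrefl unfolding ends_def by blast
  next
    assume uw: "u \<noteq> w \<and> ends u \<inter> ends w \<noteq> {}"
    then obtain K L where "K \<in> F" "L \<in> F" "u \<in> K" "w \<in> L" "h K = h L"
      unfolding ends_def by blast
    then have "u \<approx> w"
      using inj_onD[OF h] clqD clq by metis
    then show "E u w"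
      using uw by (simp add: adjeq_def)
  qed
  ultimately show ?thesis
    unfolding is_line_graph_of_multigraph_def by blast
qed

lemma line_graph_if_private_big_nbrs:
  assumes small: "\<And>v. v \<in> V \<Longrightarrow> \<not> big v \<Longrightarrow>
    \<exists>x y. big x \<and> big y \<and> v \<approx> x \<and> v \<approx> y \<and> \<not> x \<approx> y \<and> (\<forall>w. x \<approx> w \<longrightarrow> w \<approx> y \<longrightarrow> w = v)"
  shows "is_line_graph_of_multigraph V E"
proof -
  have unique: "{P, Q} = {P', Q'}" if uV: "u \<in> V" and s: "split u P Q" "split u P' Q'" for u P Q P' Q'
  proof (cases "big u")
    case True
    then show ?thesis
      using s by (rule big_split_unique)
  next
    case False
    then obtain x y where "u \<approx> x" "u \<approx> y" "\<not> x \<approx> y" "\<And>w. x \<approx> w \<Longrightarrow> w \<approx> y \<Longrightarrow> w = u"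
      using small[OF uV] by blast
    then show ?thesis
      by (rule split_unique_private_nbrs[OF s uV])
  qed
  \<comment> \<open>\<open>big_split_nbr\<close> turns \<open>K\<close> into a clique of a split at
    \<open>u\<close>, and this split is unique.\<close>
  have nbr: "K \<in> {P, Q}" if u: "u \<in> V" "split u P Q" and K: "K \<in> big_cliques" "u \<in> K" for u P Q K
  proof -
    obtain v L where "big v" "split v K L"
      using K(1) unfolding big_cliques_def by blast
    then obtain R where "split u K R"
      using big_split_nbr K(2) by blast
    then show ?thesis
      using unique[OF u, of K R] by blast
  qed
  have main: "P \<in> big_cliques \<and> Q \<in> big_cliques \<and> P \<noteq> Q"
    if uV: "u \<in> V" and s: "split u P Q" for u P Q
  proof (cases "big u")
    case True
    then show ?thesis
      using s split_sym[OF s] big_not_clq splitD(1,3)[OF s] unfolding big_cliques_def by auto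
  next
    case False
    then obtain x y where xy: "big x" "big y" "u \<approx> x" "u \<approx> y" "\<not> x \<approx> y"
      using small[OF uV] by blast
    \<comment> \<open>The big neighbours \<open>x\<close> and \<open>y\<close> each share a big
      clique with \<open>u\<close>. As they are nonadjacent, these cliques differ, so by
      \<open>nbr\<close> they are \<open>P\<close> and \<open>Q\<close>.\<close>
    have ex: "\<exists>K\<in>big_cliques. z \<in> K \<and> u \<in> K" if z: "big z" "u \<approx> z" for z
    proof -
      note zV = big_in_V[OF z(1)]
      obtain P' Q' where s': "split z P' Q'"
        using split_exists[OF zV] .
      have "u \<in> P' \<union> Q'"
        unfolding splitD(1)[OF s'] using adjeq_sym[OF z(2)] by simp
      then show ?thesis
        using s' split_sym[OF s'] z(1) split_self[OF s' zV] unfolding big_cliques_def by blast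
    qed
    obtain K L where K: "K \<in> big_cliques" "x \<in> K" "u \<in> K" and L: "L \<in> big_cliques" "y \<in> L" "u \<in> L"
      using ex xy by meson
    have "clq K"
      using K(1) splitD(3) unfolding big_cliques_def by blast
    then have "K \<noteq> L"
      using K L xy(5) clqD by blast
    then show ?thesis
      using nbr[OF uV s K(1,3)] nbr[OF uV s L(1,3)] K(1) L(1) by blast
  qed
  show ?thesis
  proof (rule line_graph_of_krausz_family)
    show clq: "clq K" if "K \<in> big_cliques" for K
      using that splitD(3) unfolding big_cliques_def by blast
    have "big_cliques \<subseteq> Pow V"
      using clq clq_subset_V by blast
    then show "finite big_cliques"
      using finite_V finite_subset by blast
    show "card {K \<in> big_cliques. u \<in> K} = 2" if uV: "u \<in> V" for u
    proof -
      obtain P Q where s: "split u P Q"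
        using split_exists[OF uV] .
      have "{K \<in> big_cliques. u \<in> K} = {P, Q}"
        using nbr[OF uV s] main[OF uV s] split_self[OF s uV] by blast
      then show ?thesis
        using main[OF uV s] by simp
    qed
    show "\<exists>K\<in>big_cliques. u \<in> K \<and> w \<in> K" if uw: "E u w" for u w
    proof -
      have uV: "u \<in> V" and "u \<approx> w"
        using uw E_in_V by (auto simp: adjeq_def)
      obtain P Q where s: "split u P Q"
        using split_exists[OF uV] .
      have "w \<in> P \<union> Q"
        unfolding splitD(1)[OF s] using \<open>u \<approx> w\<close> by simp
      then show ?thesis
        using main[OF uV s] split_self[OF s uV] by blast
    qed
  qed
qed

end

theorem mainTheorem3:
  fixes V :: "'a set" and E :: "'a \<Rightarrow> 'a \<Rightarrow> bool"
  assumes "sgraph V E" and "quasi_line V E"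
  shows "is_line_graph_of_multigraph V E \<or>
    (\<exists>v\<in>V. \<exists>S. S \<subseteq> nbhd V E v \<and>
       (\<forall>u\<in>S \<union> {v}. sq_degree V E u \<le> clique_number V E ^ 2 + clique_number V E) \<and>
       (\<forall>x\<in>nbhd V E v - S. \<forall>y\<in>nbhd V E v - S. x \<noteq> y \<longrightarrow>
          sq_adj (V - {v}) (del_vertex E v) x y))"
proof (rule disjCI)
  interpret quasi_line_graph V E
    using assms by unfold_locales
  assume no: "\<not> (\<exists>v\<in>V. \<exists>S. S \<subseteq> nbhd V E v \<and>
       (\<forall>u\<in>S \<union> {v}. sq_degree V E u \<le> clique_number V E ^ 2 + clique_number V E) \<and>
       (\<forall>x\<in>nbhd V E v - S. \<forall>y\<in>nbhd V E v - S. x \<noteq> y \<longrightarrow>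
          sq_adj (V - {v}) (del_vertex E v) x y))"
  show "is_line_graph_of_multigraph V E"
  proof (rule line_graph_if_private_big_nbrs)
    fix v assume v: "v \<in> V" "\<not> big v"
    \<comment> \<open>The largest choice that the degree condition allows, so that only big
      neighbours remain outside \<open>S\<close>.\<close>
    define S where "S = {u \<in> nbhd V E v. \<not> big u}"
    have "S \<subseteq> nbhd V E v" "\<forall>u\<in>S \<union> {v}. sq_degree V E u \<le> \<omega>\<^sup>2 + \<omega>"
      using v unfolding S_def nbhd_def big_def by auto
    then obtain x y where x: "x \<in> nbhd V E v - S" and y: "y \<in> nbhd V E v - S" and "x \<noteq> y"
      and far: "\<not> sq_adj (V - {v}) (del_vertex E v) x y"
      using no v(1) by blast
    have xy: "big x" "big y" "E v x" "E v y" "x \<in> V" "y \<in> V" "x \<noteq> v" "y \<noteq> v"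
      using x y E_irrefl unfolding S_def nbhd_def by auto
    \<comment> \<open>A path of length two from \<open>x\<close> to \<open>y\<close> survives the
      deletion of \<open>v\<close> unless \<open>v\<close> is its middle vertex.\<close>
    have nE: "\<not> E x y" and w: "\<And>w. E x w \<Longrightarrow> E w y \<Longrightarrow> w = v"
      using far xy \<open>x \<noteq> y\<close> E_in_V unfolding sq_adj_def del_vertex_def by blast+
    have "\<not> x \<approx> y" "v \<approx> x" "v \<approx> y" "\<forall>w. x \<approx> w \<longrightarrow> w \<approx> y \<longrightarrow> w = v"
      using nE w \<open>x \<noteq> y\<close> xy v(1) unfolding adjeq_def by blast+
    then show "\<exists>x y. big x \<and> big y \<and> v \<approx> x \<and> v \<approx> y \<and> \<not> x \<approx> y \<and>
        (\<forall>w. x \<approx> w \<longrightarrow> w \<approx> y \<longrightarrow> w = v)"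
      using xy(1,2) by blast
  qed
qed

end
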